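(* Let $s,t\ge 2$ be integers. For every $n\ge 0$, the number of partitions of $n$ which are $s$-regular and $t$-distinct equals the number of partitions of $n$ which are $t$-regular and $s$-distinct.
   Context: A partition is $m$-regular if none of its parts is divisible by $m$, and $m$-distinct if no part appears $m$ or more times. *)

theory Defs
  imports Main "HOL-Library.Multiset"
begin

definition partitions_of :: "nat \<Rightarrow> nat multiset set" where
  "partitions_of n = {P. (\<forall>p \<in># P. 0 < p) \<and> sum_mset P = n}"

definition regular_partition :: "nat \<Rightarrow> nat multiset \<Rightarrow> bool" where
  "regular_partition m P \<longleftrightarrow> (\<forall>p \<in># P. \<not> m dvd p)"

definition distinct_partition :: "nat \<Rightarrow> nat multiset \<Rightarrow> bool" where
  "distinct_partition m P \<longleftrightarrow> (\<forall>p \<in># P. count P p < m)"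

end

theory Submission
  imports Defs "HOL-Computational_Algebra.Formal_Power_Series"
begin

text \<open>
  Let \<open>P\<close>, \<open>R\<close> and \<open>D\<close> be the generating functions of all partitions, of the \<open>s\<close>-regular ones,
  and of those that are \<open>s\<close>-regular and \<open>t\<close>-distinct. Separating the parts divisible by \<open>s\<close> gives
  \<open>P(q) = R(q) P(q^s)\<close>, and dividing all multiplicities by \<open>t\<close> with remainder gives
  \<open>R(q) = D(q) R(q^t)\<close>. Hence \<open>D(q) P(q^s) P(q^t) = P(q) P(q^(s t))\<close>, which determines \<open>D\<close> and is
  symmetric in \<open>s\<close> and \<open>t\<close>.
\<close>

text \<open>The weight is kept as a parameter so that the substitution of q^c for q becomes the
  weight \<open>c * sum_mset P\<close>, without composing power series. Integer coefficients make
  the series an integral domain, where nonzero factors cancel.\<close>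

definition gen_fun :: "('a \<Rightarrow> nat) \<Rightarrow> 'a set \<Rightarrow> int fps" where
  "gen_fun w A = Abs_fps (\<lambda>n. int (card {x \<in> A. w x = n}))"

text \<open>The elements of \<open>C\<close> of weight n correspond to pairs whose weights are i and
  n - i, so their number is the Cauchy product coefficient. Finiteness of the level sets matters
  because \<open>card\<close> is 0 on infinite sets.\<close>

lemma gen_fun_mult:
  assumes bij: "bij_betw f (A \<times> B) C"
    and weight: "\<And>a b. a \<in> A \<Longrightarrow> b \<in> B \<Longrightarrow> w (f (a, b)) = u a + v b"
    and finA: "\<And>n. finite {a \<in> A. u a = n}"
    and finB: "\<And>n. finite {b \<in> B. v b = n}"
  shows "gen_fun w C = gen_fun u A * gen_fun v B"
proof (rule fps_ext)
  fix n
  let ?F = "\<lambda>i. {a \<in> A. u a = i} \<times> {b \<in> B. v b = n - i}"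
  have "bij_betw f (\<Union>i\<in>{0..n}. ?F i) {c \<in> C. w c = n}"
  proof (rule bij_betw_subset[OF bij])
    show "(\<Union>i\<in>{0..n}. ?F i) \<subseteq> A \<times> B" by auto
    show "f ` (\<Union>i\<in>{0..n}. ?F i) = {c \<in> C. w c = n}"
    proof (intro equalityI subsetI)
      fix c assume "c \<in> f ` (\<Union>i\<in>{0..n}. ?F i)"
      then show "c \<in> {c \<in> C. w c = n}"
        using weight bij_betw_apply[OF bij] by fastforce
    next
      fix c assume c: "c \<in> {c \<in> C. w c = n}"
      then have "c \<in> f ` (A \<times> B)" using bij_betw_imp_surj_on[OF bij] by auto
      then obtain a b where ab: "a \<in> A" "b \<in> B" "c = f (a, b)" by auto
      with weight[of a b] c have "u a + v b = n" by simp
      with ab have "u a \<in> {0..n}" "(a, b) \<in> ?F (u a)" by auto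
      with ab show "c \<in> f ` (\<Union>i\<in>{0..n}. ?F i)" by blast
    qed
  qed
  then have "card {c \<in> C. w c = n} = card (\<Union>i\<in>{0..n}. ?F i)"
    by (simp add: bij_betw_same_card)
  also have "\<dots> = (\<Sum>i=0..n. card (?F i))"
    \<comment> \<open>The sets for different i are disjoint, since i is recovered from a pair as
      \<open>u a\<close>.\<close>
    by (rule card_UN_disjoint) (use finA finB in auto)
  finally show "fps_nth (gen_fun w C) n = fps_nth (gen_fun u A * gen_fun v B) n"
    by (simp add: gen_fun_def fps_mult_nth card_cartesian_product)
qed

definition positive_parts :: "nat multiset set" where
  "positive_parts = {P. \<forall>p \<in># P. 0 < p}"

text \<open>Positive parts with sum n are at most n in number and at most n in size, so every such
  multiset comes from one of finitely many lists.\<close>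

lemma finite_partitions_of: "finite (partitions_of n)"
proof (rule finite_subset)
  show "partitions_of n \<subseteq> mset ` {xs. set xs \<subseteq> {..n} \<and> length xs \<le> n}"
  proof
    fix P assume "P \<in> partitions_of n"
    then have pos: "\<forall>p \<in># P. 0 < p" and sum: "sum_mset P = n"
      by (auto simp: partitions_of_def)
    obtain xs where xs: "mset xs = P" using ex_mset by blast
    have "length ys \<le> sum_list ys" if "\<forall>y \<in> set ys. 0 < y" for ys :: "nat list"
      using that by (induction ys) auto
    moreover have "\<forall>x \<in> set xs. 0 < x" using pos xs by auto
    ultimately have "length xs \<le> n" using sum xs by (metis sum_mset_sum_list)
    moreover have "set xs \<subseteq> {..n}"
      using sum xs by (auto simp: sum_mset_sum_list intro: member_le_sum_list)
    ultimately show "P \<in> mset ` {xs. set xs \<subseteq> {..n} \<and> length xs \<le> n}" using xs by blast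
  qed
  show "finite (mset ` {xs. set xs \<subseteq> {..n} \<and> length xs \<le> n})"
    by (intro finite_imageI finite_lists_length_le) simp
qed

lemma finite_scaled_partitions:
  assumes "0 < c" "A \<subseteq> positive_parts"
  shows "finite {P \<in> A. c * sum_mset P = n}"
proof (rule finite_subset)
  show "{P \<in> A. c * sum_mset P = n} \<subseteq> partitions_of (n div c)"
    using assms by (auto simp: positive_parts_def partitions_of_def)
qed (rule finite_partitions_of)

text \<open>Only the empty partition has weight 0, so the constant term is 1. This licenses the
  final cancellation.\<close>

lemma gen_fun_positive_parts_nonzero:
  assumes "0 < c"
  shows "gen_fun (\<lambda>P. c * sum_mset P) positive_parts \<noteq> 0"
proof -
  have "{P \<in> positive_parts. c * sum_mset P = 0} = {{#}}"
  proof (intro equalityI subsetI)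
    fix P assume "P \<in> {P \<in> positive_parts. c * sum_mset P = 0}"
    then have "\<forall>p \<in># P. 0 < p" "\<forall>p \<in># P. p = 0"
      using assms by (auto simp: positive_parts_def)
    then have "set_mset P = {}" by fastforce
    then show "P \<in> {{#}}" by simp
  qed (simp add: positive_parts_def)
  then have "fps_nth (gen_fun (\<lambda>P. c * sum_mset P) positive_parts) 0 = 1"
    by (simp add: gen_fun_def)
  then show ?thesis by auto
qed

definition regulars :: "nat \<Rightarrow> nat multiset set" where
  "regulars s = {P \<in> positive_parts. regular_partition s P}"

definition regular_distincts :: "nat \<Rightarrow> nat \<Rightarrow> nat multiset set" where
  "regular_distincts s t = {P \<in> regulars s. distinct_partition t P}"

lemma bij_betw_split_divisible_parts:
  assumes "0 < s"
  shows "bij_betw (\<lambda>(R, Q). R + image_mset ((*) s) Q) (regulars s \<times> positive_parts) positive_parts"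
proof (rule bij_betw_byWitness[where f' = "\<lambda>P. (filter_mset (\<lambda>p. \<not> s dvd p) P,
        image_mset (\<lambda>p. p div s) (filter_mset ((dvd) s) P))"])
  show "\<forall>RQ \<in> regulars s \<times> positive_parts.
    (\<lambda>P. (filter_mset (\<lambda>p. \<not> s dvd p) P, image_mset (\<lambda>p. p div s) (filter_mset ((dvd) s) P)))
      ((\<lambda>(R, Q). R + image_mset ((*) s) Q) RQ) = RQ"
  proof clarsimp
    fix R Q assume "R \<in> regulars s"
    then have "\<forall>p \<in># R. \<not> s dvd p" by (auto simp: regulars_def regular_partition_def)
    then have "filter_mset (\<lambda>p. \<not> s dvd p) R = R" "filter_mset ((dvd) s) R = {#}"
      by (auto simp: filter_mset_eq_conv)
    then show "filter_mset (\<lambda>p. \<not> s dvd p) R + filter_mset (\<lambda>p. \<not> s dvd p) (image_mset ((*) s) Q) = R \<and>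
      image_mset (\<lambda>p. p div s) (filter_mset ((dvd) s) R) +
      image_mset (\<lambda>p. p div s) (filter_mset ((dvd) s) (image_mset ((*) s) Q)) = Q"
      using assms by (simp add: filter_mset_image_mset multiset.map_comp comp_def)
  qed
  show "\<forall>P \<in> positive_parts. (\<lambda>(R, Q). R + image_mset ((*) s) Q)
     (filter_mset (\<lambda>p. \<not> s dvd p) P, image_mset (\<lambda>p. p div s) (filter_mset ((dvd) s) P)) = P"
  proof
    fix P :: "nat multiset"
    \<comment> \<open>Dividing by \<open>s\<close> and multiplying back is the identity on multiples
      of \<open>s\<close>, and only those survive the filter.\<close>
    have "image_mset ((*) s \<circ> (\<lambda>p. p div s)) (filter_mset ((dvd) s) P) = filter_mset ((dvd) s) P"
      by (rule multiset.map_ident_strong) auto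
    then show "(\<lambda>(R, Q). R + image_mset ((*) s) Q)
     (filter_mset (\<lambda>p. \<not> s dvd p) P, image_mset (\<lambda>p. p div s) (filter_mset ((dvd) s) P)) = P"
      using multiset_partition[of P "(dvd) s"] by (simp add: multiset.map_comp union_commute)
  qed
  show "(\<lambda>(R, Q). R + image_mset ((*) s) Q) ` (regulars s \<times> positive_parts) \<subseteq> positive_parts"
    using assms by (auto simp: regulars_def positive_parts_def)
  show "(\<lambda>P. (filter_mset (\<lambda>p. \<not> s dvd p) P, image_mset (\<lambda>p. p div s) (filter_mset ((dvd) s) P)))
      ` positive_parts \<subseteq> regulars s \<times> positive_parts"
    \<comment> \<open>A positive multiple of \<open>s\<close> is at least \<open>s\<close>, so its
      quotient by \<open>s\<close> is again a positive part.\<close>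
    using assms
    by (auto simp: regulars_def positive_parts_def regular_partition_def div_greater_zero_iff dvd_imp_le)
qed

text \<open>Numbers that are not parts have count 0, which is below \<open>t\<close>. The bound at
  every p is what uniqueness of remainders calls for.\<close>

lemma distinct_partition_iff_count_less:
  assumes "0 < t"
  shows "distinct_partition t P \<longleftrightarrow> (\<forall>p. count P p < t)"
  using assms unfolding distinct_partition_def by (metis count_inI)

text \<open>Each multiplicity is uniquely r + t * q with r < t; \<open>R\<close> collects the
  remainders and \<open>Q\<close> the quotients. No new part values arise in either direction, so
  \<open>s\<close>-regularity is preserved.\<close>

lemma bij_betw_split_multiplicities:
  assumes "0 < t"
  shows "bij_betw (\<lambda>(R, Q). R + repeat_mset t Q) (regular_distincts s t \<times> regulars s) (regulars s)"
proof (rule bij_betw_imageI)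
  show "inj_on (\<lambda>(R, Q). R + repeat_mset t Q) (regular_distincts s t \<times> regulars s)"
  proof (rule inj_onI, clarsimp)
    fix R Q R' Q'
    assume "R \<in> regular_distincts s t" "R' \<in> regular_distincts s t"
      and eq: "R + repeat_mset t Q = R' + repeat_mset t Q'"
    then have less: "count R p < t" "count R' p < t" for p
      using assms by (auto simp: regular_distincts_def distinct_partition_iff_count_less)
    have "count R p + t * count Q p = count R' p + t * count Q' p" for p
      using arg_cong[OF eq, of "\<lambda>M. count M p"] by simp
    \<comment> \<open>Since the counts in \<open>R\<close> and \<open>R'\<close> are below
      \<open>t\<close>, the remainders give back these counts and the quotients those of
      \<open>Q\<close> and \<open>Q'\<close>.\<close>
    then have "(count R p + t * count Q p) mod t = (count R' p + t * count Q' p) mod t"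
      "(count R p + t * count Q p) div t = (count R' p + t * count Q' p) div t" for p by simp_all
    then show "R = R' \<and> Q = Q'" using less assms by (simp add: multiset_eq_iff)
  qed
  show "(\<lambda>(R, Q). R + repeat_mset t Q) ` (regular_distincts s t \<times> regulars s) = regulars s"
  proof (intro equalityI subsetI)
    fix P assume "P \<in> (\<lambda>(R, Q). R + repeat_mset t Q) ` (regular_distincts s t \<times> regulars s)"
    then obtain R Q where "R \<in> regulars s" "Q \<in> regulars s" "P = R + repeat_mset t Q"
      by (auto simp: regular_distincts_def)
    moreover from this(3) have "set_mset P \<subseteq> set_mset R \<union> set_mset Q"
      by (auto simp flip: count_greater_zero_iff)
    ultimately show "P \<in> regulars s"
      by (auto simp: regulars_def positive_parts_def regular_partition_def)
  next
    fix P assume P: "P \<in> regulars s"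
    define R where "R = Abs_multiset (\<lambda>p. count P p mod t)"
    define Q where "Q = Abs_multiset (\<lambda>p. count P p div t)"
    \<comment> \<open>\<open>Abs_multiset\<close> has the prescribed counts only for functions of
      finite support; here both supports lie inside that of \<open>P\<close>.\<close>
    have "{p. 0 < count P p mod t} \<subseteq> set_mset P" "{p. 0 < count P p div t} \<subseteq> set_mset P"
      by (auto intro: count_inI)
    then have "finite {p. 0 < count P p mod t}" "finite {p. 0 < count P p div t}"
      using finite_subset by blast+
    then have R: "count R p = count P p mod t" and Q: "count Q p = count P p div t" for p
      unfolding R_def Q_def by (simp_all add: count_Abs_multiset)
    have "set_mset R \<subseteq> set_mset P" "set_mset Q \<subseteq> set_mset P"
      by (auto simp: R Q intro: count_inI simp flip: count_greater_zero_iff)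
    then have "R \<in> regulars s" "Q \<in> regulars s"
      using P by (auto simp: regulars_def positive_parts_def regular_partition_def)
    moreover have "distinct_partition t R"
      using assms R by (simp add: distinct_partition_iff_count_less)
    moreover have "P = R + repeat_mset t Q" by (simp add: multiset_eq_iff R Q)
    ultimately show "P \<in> (\<lambda>(R, Q). R + repeat_mset t Q) ` (regular_distincts s t \<times> regulars s)"
      by (force simp: regular_distincts_def)
  qed
qed

text \<open>Scaling the parts of \<open>Q\<close> by \<open>s\<close> scales their sum by
  \<open>s\<close>. The extra factor \<open>c\<close> allows the identity to be used both at q and
  at q^t.\<close>

lemma gen_fun_positive_parts_eq:
  assumes "0 < c" "0 < s"
  shows "gen_fun (\<lambda>P. c * sum_mset P) positive_parts =
    gen_fun (\<lambda>P. c * sum_mset P) (regulars s) * gen_fun (\<lambda>P. (c * s) * sum_mset P) positive_parts"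
proof (rule gen_fun_mult[OF bij_betw_split_divisible_parts[OF assms(2)]])
  fix R Q
  show "c * sum_mset ((\<lambda>(R, Q). R + image_mset ((*) s) Q) (R, Q)) =
    c * sum_mset R + c * s * sum_mset Q"
    by (simp add: algebra_simps flip: sum_mset_distrib_left)
next
  show "finite {P \<in> regulars s. c * sum_mset P = n}" for n
    using assms by (intro finite_scaled_partitions) (auto simp: regulars_def)
  show "finite {P \<in> positive_parts. c * s * sum_mset P = n}" for n
    using assms by (intro finite_scaled_partitions) auto
qed

lemma sum_mset_repeat_mset: "sum_mset (repeat_mset k M) = k * sum_mset (M :: nat multiset)"
  by (induction k) auto

lemma gen_fun_regulars_eq:
  assumes "0 < t"
  shows "gen_fun (\<lambda>P. 1 * sum_mset P) (regulars s) =
    gen_fun (\<lambda>P. 1 * sum_mset P) (regular_distincts s t) * gen_fun (\<lambda>P. t * sum_mset P) (regulars s)"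
proof (rule gen_fun_mult[OF bij_betw_split_multiplicities[OF assms]])
  fix R Q
  show "1 * sum_mset ((\<lambda>(R, Q). R + repeat_mset t Q) (R, Q)) = 1 * sum_mset R + t * sum_mset Q"
    by (simp add: sum_mset_repeat_mset)
next
  show "finite {P \<in> regular_distincts s t. 1 * sum_mset P = n}" for n
    by (rule finite_scaled_partitions) (auto simp: regular_distincts_def regulars_def)
  show "finite {P \<in> regulars s. t * sum_mset P = n}" for n
    using assms by (intro finite_scaled_partitions) (auto simp: regulars_def)
qed

lemma gen_fun_regular_distincts:
  assumes "0 < s" "0 < t"
  shows "gen_fun (\<lambda>P. 1 * sum_mset P) (regular_distincts s t) *
      (gen_fun (\<lambda>P. s * sum_mset P) positive_parts * gen_fun (\<lambda>P. t * sum_mset P) positive_parts) =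
    gen_fun (\<lambda>P. 1 * sum_mset P) positive_parts * gen_fun (\<lambda>P. (s * t) * sum_mset P) positive_parts"
proof -
  let ?P = "\<lambda>c. gen_fun (\<lambda>P. c * sum_mset P) positive_parts"
  let ?R = "\<lambda>c. gen_fun (\<lambda>P. c * sum_mset P) (regulars s)"
  let ?D = "gen_fun (\<lambda>P. 1 * sum_mset P) (regular_distincts s t)"
  \<comment> \<open>Only \<open>?P t\<close> is expanded: this produces the \<open>?R t\<close> that
    \<open>?D\<close> turns into \<open>?R 1\<close>, which then absorbs \<open>?P s\<close> to give
    \<open>?P 1\<close>.\<close>
  have "?D * (?P s * ?P t) = ?D * (?P s * (?R t * ?P (t * s)))"
    by (subst gen_fun_positive_parts_eq[OF assms(2,1)]) (rule refl)
  also have "\<dots> = (?D * ?R t) * ?P s * ?P (s * t)"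
    by (simp only: ac_simps)
  also have "?D * ?R t = ?R 1"
    by (rule gen_fun_regulars_eq[OF assms(2), symmetric])
  also have "?R 1 * ?P s = ?P 1"
    using gen_fun_positive_parts_eq[OF zero_less_one assms(1), symmetric] unfolding mult_1 .
  finally show ?thesis .
qed

theorem theorem5:
  fixes s t n :: nat
  assumes "s \<ge> 2" and "t \<ge> 2"
  shows "card {P \<in> partitions_of n. regular_partition s P \<and> distinct_partition t P} =
         card {P \<in> partitions_of n. regular_partition t P \<and> distinct_partition s P}"
proof -
  let ?G = "\<lambda>c. gen_fun (\<lambda>P. c * sum_mset P) positive_parts"
  let ?D = "\<lambda>s t. gen_fun (\<lambda>P. 1 * sum_mset P) (regular_distincts s t)"
  have pos: "0 < s" "0 < t" using assms by auto
  have "?D s t * (?G s * ?G t) = ?G 1 * ?G (s * t)"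
    by (rule gen_fun_regular_distincts[OF pos])
  \<comment> \<open>The right-hand side depends on \<open>s\<close> and \<open>t\<close> only
    through their product, so exchanging them leaves it unchanged.\<close>
  also have "\<dots> = ?D t s * (?G s * ?G t)"
    using gen_fun_regular_distincts[OF pos(2,1)] by (simp only: mult.commute)
  finally have "?D s t = ?D t s"
    using gen_fun_positive_parts_nonzero[OF pos(1)] gen_fun_positive_parts_nonzero[OF pos(2)] by simp
  \<comment> \<open>The n-th coefficient counts exactly the partitions in the claim, so equal series
    give equal cardinalities.\<close>
  moreover have "fps_nth (?D a b) n =
      int (card {P \<in> partitions_of n. regular_partition a P \<and> distinct_partition b P})" for a b
    unfolding gen_fun_def regular_distincts_def regulars_def positive_parts_def partitions_of_def
    by (auto intro!: arg_cong[of _ _ card])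
  ultimately show ?thesis by (metis of_nat_eq_iff)
qed

end
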